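(* Consider the system with state $\mathbf{x}=(x,y,v,\theta)\in\mathbb{R}^4$ and inputs $u=(u_v,u_\theta)\in\mathbb{R}^2$, $$\dot x=v\cos\theta,\quad \dot y=v\sin\theta,\quad \dot v=u_v,\quad \dot\theta=u_\theta,$$ with initial state $\mathbf{x}_0=(x_0,y_0,v_0,\theta_0)$. Let $h_1(x,y)$ and $\hbar_1(x,y)$ be twice continuously differentiable parallel positional constraints, $h_1+\hbar_1=b_1$ with $b_1>0$ constant, and suppose $h_1(x_0,y_0)>0$ and $\hbar_1(x_0,y_0)>0$. Let $$h_2(\mathbf{x})=c_1h_1(x,y)+L_fh_1(\mathbf{x}),\qquad \hbar_2(\mathbf{x})=b_2-h_2(\mathbf{x}),\qquad b_2=c_1b_1,$$ where the gain $c_1$ satisfies $$c_1>\max\left\{-\frac{L_fh_1(\mathbf{x}_0)}{h_1(x_0,y_0)},\ \frac{L_fh_1(\mathbf{x}_0)}{b_1-h_1(x_0,y_0)}\right\}.$$ If $\nabla_{x,y}h_1(x,y)\ne0$ for all $(x,y)\in\mathcal{C}_h\cap\mathcal{C}_{\hbar}$, then $h_2$ and $\hbar_2$ are valid CBFs in the set $\mathcal{C}_{h_2}\cap\mathcal{C}_{\hbar_2}$.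
   Context: The system is written $\dot{\mathbf{x}}=f(\mathbf{x})+g(\mathbf{x})u$ with $f(\mathbf{x})=(v\cos\theta,v\sin\theta,0,0)^\top$ and $g(\mathbf{x})=[g_v,g_\theta]$, $g_v=(0,0,1,0)^\top$, $g_\theta=(0,0,0,1)^\top$; the input is unbounded. $L_fh=\nabla h^\top f$ and $L_gh=\nabla h^\top g=[L_{g_v}h,L_{g_\theta}h]$. In particular $L_fh_1(\mathbf{x})=v\,\nabla_{x,y}h_1(x,y)^\top(\cos\theta,\sin\theta)^\top$, where $\nabla_{x,y}$ is the gradient in $(x,y)$. Parallel positional constraints: $h_1,\hbar_1$ are barrier function candidates depending only on $(x,y)$ (continuously differentiable, taking both negative infimum and positive supremum) with $h_1+\hbar_1$ equal to a positive constant $b_1$. Sets: $\mathcal{C}_h=\{h_1\ge0\}$ and $\mathcal{C}_{\hbar}=\{\hbar_1\ge0\}$ (conditions on $(x,y)$ only; also regarded as sets of states $\mathbf{x}\in\mathbb{R}^4$), $\mathcal{C}_{h_2}=\mathcal{C}_h\cap\{\mathbf{x}\mid h_2(\mathbf{x})\ge0\}$, $\mathcal{C}_{\hbar_2}=\mathcal{C}_{\hbar}\cap\{\mathbf{x}\mid\hbar_2(\mathbf{x})\ge0\}$. Extended class $\mathcal{K}_\infty$ function: a continuous strictly increasing $\alpha:\mathbb{R}\to\mathbb{R}$ with $\alpha(0)=0$ and $\alpha(s)\to\pm\infty$ as $s\to\pm\infty$. Valid CBFs in the set $\mathcal{C}_{h_2}\cap\mathcal{C}_{\hbar_2}$: there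 are extended class $\mathcal{K}_\infty$ functions $\alpha_2,\overline{\alpha}_2$ such that for all $\mathbf{x}\in\mathcal{C}_{h_2}\cap\mathcal{C}_{\hbar_2}$: $L_gh_2(\mathbf{x})=0\implies L_fh_2(\mathbf{x})\ge-\alpha_2(h_2(\mathbf{x}))$, and $L_g\hbar_2(\mathbf{x})=0\implies L_f\hbar_2(\mathbf{x})\ge-\overline{\alpha}_2(\hbar_2(\mathbf{x}))$. *)

theory Defs
  imports "HOL-Analysis.Analysis"
begin

definition grad :: "('a::real_inner \<Rightarrow> real) \<Rightarrow> 'a \<Rightarrow> 'a" where
  "grad h x = (THE D. GDERIV h x :> D)"

lemma grad_eqI:
  assumes "GDERIV h x :> D"
  shows "grad h x = D"
  unfolding grad_def
proof (rule the_equality)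
  show "GDERIV h x :> D" by (fact assms)
next
  fix D' assume "GDERIV h x :> D'"
  with assms have "(\<lambda>v. inner v D') = (\<lambda>v. inner v D)"
    unfolding gderiv_def by (metis has_derivative_unique)
  then have "inner v D' = inner v D" for v by metis
  then show "D' = D" by (metis inner_commute vector_eq_ldot)
qed

definition C1 :: "('a::real_normed_vector \<Rightarrow> 'b::real_normed_vector) \<Rightarrow> bool" where
  "C1 F \<longleftrightarrow> (\<exists>F' :: 'a \<Rightarrow> 'a \<Rightarrow>\<^sub>L 'b.
     (\<forall>x. (F has_derivative blinfun_apply (F' x)) (at x)) \<and> continuous_on UNIV F')"

definition C2 :: "('a::real_inner \<Rightarrow> real) \<Rightarrow> bool" where
  "C2 h \<longleftrightarrow> C1 h \<and> C1 (grad h)"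

text \<open>Infimum and supremum are taken in the extended reals because a candidate may be unbounded.\<close>

definition barrier_candidate :: "('a::real_normed_vector \<Rightarrow> real) \<Rightarrow> bool" where
  "barrier_candidate h \<longleftrightarrow> C1 h \<and> (INF z. ereal (h z)) < 0 \<and> 0 < (SUP z. ereal (h z))"

definition parallel_constraints :: "real \<Rightarrow> (real^2 \<Rightarrow> real) \<Rightarrow> (real^2 \<Rightarrow> real) \<Rightarrow> bool" where
  "parallel_constraints b h k \<longleftrightarrow>
     barrier_candidate h \<and> barrier_candidate k \<and> 0 < b \<and> (\<forall>p. h p + k p = b)"

definition safe_set :: "('a \<Rightarrow> real) \<Rightarrow> 'a set" where
  "safe_set h = {z. 0 \<le> h z}"

text \<open>States are vectors \<open>(x, y, v, \<theta>)\<close>. For an input \<open>u = (u\<^sub>v, u\<^sub>\<theta>)\<close> the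
  dynamics read \<open>drift x + input_matrix x *v u\<close>.\<close>

definition pos :: "real^4 \<Rightarrow> real^2" where
  "pos x = vector [x $ 1, x $ 2]"

definition drift :: "real^4 \<Rightarrow> real^4" where
  "drift x = vector [x $ 3 * cos (x $ 4), x $ 3 * sin (x $ 4), 0, 0]"

definition g\<^sub>v :: "real^4" where
  "g\<^sub>v = vector [0, 0, 1, 0]"

definition g\<^sub>\<theta> :: "real^4" where
  "g\<^sub>\<theta> = vector [0, 0, 0, 1]"

definition input_matrix :: "real^4 \<Rightarrow> real^2^4" where
  "input_matrix x = transpose (vector [g\<^sub>v, g\<^sub>\<theta>])"

definition L_f :: "(real^4 \<Rightarrow> real) \<Rightarrow> real^4 \<Rightarrow> real" where
  "L_f h x = grad h x \<bullet> drift x"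

definition L_g :: "(real^4 \<Rightarrow> real) \<Rightarrow> real^4 \<Rightarrow> real^2" where
  "L_g h x = grad h x v* input_matrix x"

definition ext_class_K_inf :: "(real \<Rightarrow> real) \<Rightarrow> bool" where
  "ext_class_K_inf \<alpha> \<longleftrightarrow> continuous_on UNIV \<alpha> \<and> strict_mono \<alpha> \<and> \<alpha> 0 = 0 \<and>
     filterlim \<alpha> at_top at_top \<and> filterlim \<alpha> at_bot at_bot"

definition valid_CBF_on :: "(real^4) set \<Rightarrow> (real^4 \<Rightarrow> real) \<Rightarrow> bool" where
  "valid_CBF_on S h \<longleftrightarrow> (\<exists>\<alpha>. ext_class_K_inf \<alpha> \<and>
     (\<forall>x\<in>S. L_g h x = 0 \<longrightarrow> L_f h x \<ge> - \<alpha> (h x)))"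

end

theory Submission
  imports Defs
begin

text \<open>The two CBF conditions only bite at states where \<open>L_g h\<^sub>2\<close> vanishes, and there the drift turns
  out to vanish too. Writing \<open>e = (cos \<theta>, sin \<theta>)\<close> for the heading and \<open>n = (- sin \<theta>, cos \<theta>)\<close> for its
  normal, \<open>h\<^sub>2 = c\<^sub>1 h\<^sub>1 + v (\<nabla>h\<^sub>1 \<bullet> e)\<close> depends on \<open>v\<close> and \<open>\<theta>\<close> only through \<open>v e\<close>, so
  \<open>L_g h\<^sub>2 = (\<nabla>h\<^sub>1 \<bullet> e, v (\<nabla>h\<^sub>1 \<bullet> n))\<close> (lemma \<open>partials_h2\<close>). As \<open>e\<close> and \<open>n\<close> form an
  orthonormal basis of the plane and \<open>\<nabla>h\<^sub>1 \<noteq> 0\<close> on the strip between the two constraints, both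
  components can vanish only if \<open>v = 0\<close> (lemma \<open>standstill_if_L_g_zero\<close>).

  At standstill the drift is zero, hence \<open>L_f h\<^sub>2 = L_f k\<^sub>2 = 0\<close>. Because \<open>h\<^sub>2\<close> and \<open>k\<^sub>2\<close> are
  nonnegative on the set in question, any extended class K-infinity function bounds these values
  as required; the identity is one. The case of \<open>k\<^sub>2 = b\<^sub>2 - h\<^sub>2\<close> is the same because
  \<open>L_g k\<^sub>2 = - L_g h\<^sub>2\<close>.\<close>

section \<open>Gradients and Lie derivatives\<close>

text \<open>As \<open>grad\<close> is a definite description, a derivative says something about it only once a vector
  representing it is exhibited; in finite dimension its coordinates are the values on the basis.\<close>

lemma has_derivative_grad:
  fixes f :: "'a::euclidean_space \<Rightarrow> real"
  assumes "(f has_derivative D) (at x)"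
  shows "D d = grad f x \<bullet> d"
proof -
  interpret D: bounded_linear D
    using assms by (rule has_derivative_bounded_linear)
  have D: "D d = d \<bullet> (\<Sum>b\<in>Basis. D b *\<^sub>R b)" for d
  proof -
    have "D d = D (\<Sum>b\<in>Basis. (d \<bullet> b) *\<^sub>R b)"
      by (simp add: euclidean_representation)
    also have "\<dots> = d \<bullet> (\<Sum>b\<in>Basis. D b *\<^sub>R b)"
      by (simp add: D.sum D.scaleR inner_sum_right mult.commute)
    finally show ?thesis .
  qed
  then have "D = (\<lambda>d. d \<bullet> (\<Sum>b\<in>Basis. D b *\<^sub>R b))"
    by blast
  with assms have "GDERIV f x :> (\<Sum>b\<in>Basis. D b *\<^sub>R b)"
    unfolding gderiv_def by metis
  then have "grad f x = (\<Sum>b\<in>Basis. D b *\<^sub>R b)"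
    by (rule grad_eqI)
  then show ?thesis
    by (subst inner_commute) (simp only: D[of d])
qed

lemma vector_4 [simp]:
  "(vector [a, b, c, d] :: 'a::zero^4) $ 1 = a"
  "(vector [a, b, c, d] :: 'a::zero^4) $ 2 = b"
  "(vector [a, b, c, d] :: 'a::zero^4) $ 3 = c"
  "(vector [a, b, c, d] :: 'a::zero^4) $ 4 = d"
  unfolding vector_def by simp_all

lemma C1_has_derivative:
  assumes "C1 f"
  obtains D where "(f has_derivative D) (at x)"
  using assms unfolding C1_def by blast

lemma L_g_components:
  "L_g h x $ 1 = grad h x \<bullet> g\<^sub>v" "L_g h x $ 2 = grad h x \<bullet> g\<^sub>\<theta>"
  by (simp_all add: L_g_def input_matrix_def vector_matrix_mult_def transpose_def inner_vec_def
      mult.commute)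

lemma L_f_standstill:
  assumes "x $ 3 = 0"
  shows "L_f h x = 0"
proof -
  have "drift x = 0"
    using assms by (simp add: drift_def vec_eq_iff forall_4)
  then show ?thesis
    by (simp add: L_f_def)
qed

lemma bounded_linear_pos: "bounded_linear pos"
  by (rule linear_conv_bounded_linear[THEN iffD1], rule linearI)
    (simp_all add: pos_def vec_eq_iff forall_2)

text \<open>Since \<open>h \<circ> pos\<close> ignores speed and heading, its Lie derivative only sees the planar part of
  the drift.\<close>

lemma L_f_pos:
  assumes "C1 h"
  shows "L_f (h \<circ> pos) x = grad h (pos x) \<bullet> pos (drift x)"
proof -
  obtain D where D: "(h has_derivative D) (at (pos x))"
    using C1_has_derivative[OF assms] .
  have "(h \<circ> pos has_derivative D \<circ> pos) (at x)"
    by (rule diff_chain_at[OF bounded_linear_imp_has_derivative[OF bounded_linear_pos] D])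
  from has_derivative_grad[OF this, of "drift x"] has_derivative_grad[OF D, of "pos (drift x)"]
  show ?thesis
    by (simp add: L_f_def)
qed

section \<open>The second-order barrier function\<close>

lemma pos_drift_has_derivative:
  "((\<lambda>x. pos (drift x)) has_derivative
     (\<lambda>d. vector [d $ 3 * cos (x $ 4) - x $ 3 * (sin (x $ 4) * d $ 4),
                  d $ 3 * sin (x $ 4) + x $ 3 * (cos (x $ 4) * d $ 4)])) (at x)"
proof -
  have vector_2_axis: "vector [a, b] = a *\<^sub>R axis 1 1 + b *\<^sub>R (axis 2 1 :: real^2)" for a b :: real
    by (simp add: vec_eq_iff forall_2 axis_def)
  have nth: "((\<lambda>x. x $ i) has_derivative (\<lambda>d. d $ i)) (at x)" for i :: 4
    by (rule bounded_linear_imp_has_derivative[OF bounded_linear_vec_nth])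
  have "((\<lambda>x. x $ 3 * cos (x $ 4)) has_derivative
      (\<lambda>d. d $ 3 * cos (x $ 4) - x $ 3 * (sin (x $ 4) * d $ 4))) (at x)"
    by (rule has_derivative_eq_rhs, rule has_derivative_mult[OF nth has_derivative_cos[OF nth]])
      (simp add: fun_eq_iff algebra_simps)
  moreover have "((\<lambda>x. x $ 3 * sin (x $ 4)) has_derivative
      (\<lambda>d. d $ 3 * sin (x $ 4) + x $ 3 * (cos (x $ 4) * d $ 4))) (at x)"
    by (rule has_derivative_eq_rhs, rule has_derivative_mult[OF nth has_derivative_sin[OF nth]])
      (simp add: fun_eq_iff algebra_simps)
  ultimately show ?thesis
    unfolding pos_def drift_def vector_4 vector_2_axis
    by (intro has_derivative_add has_derivative_scaleR_left)
qed

text \<open>The position does not move along the input directions, so the second derivative of \<open>h\<close>, which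
  enters the derivative of \<open>h\<^sub>2\<close>, is multiplied by zero there; only the derivative of the planar
  drift contributes.\<close>

lemma partials_h2:
  assumes "C2 h"
    and h2: "h2 = (\<lambda>x. c * h (pos x) + L_f (h \<circ> pos) x)"
  shows "h2 differentiable at x"
    and "grad h2 x \<bullet> g\<^sub>v = grad h (pos x) \<bullet> vector [cos (x $ 4), sin (x $ 4)]"
    and "grad h2 x \<bullet> g\<^sub>\<theta> = x $ 3 * (grad h (pos x) \<bullet> vector [- sin (x $ 4), cos (x $ 4)])"
proof -
  have C1: "C1 h" "C1 (grad h)"
    using \<open>C2 h\<close> by (simp_all add: C2_def)
  obtain D where D: "(h has_derivative D) (at (pos x))"
    using C1_has_derivative[OF C1(1)] .
  obtain H where H: "(grad h has_derivative H) (at (pos x))"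
    using C1_has_derivative[OF C1(2)] .
  note pos' = bounded_linear_imp_has_derivative[OF bounded_linear_pos, of "at x"]
  define Q where "Q = (\<lambda>d :: real^4. vector
     [d $ 3 * cos (x $ 4) - x $ 3 * (sin (x $ 4) * d $ 4),
      d $ 3 * sin (x $ 4) + x $ 3 * (cos (x $ 4) * d $ 4)] :: real^2)"
  have Q: "((\<lambda>x. pos (drift x)) has_derivative Q) (at x)"
    unfolding Q_def by (rule pos_drift_has_derivative)
  have eq: "h2 = (\<lambda>x. c * h (pos x) + grad h (pos x) \<bullet> pos (drift x))"
    using h2 L_f_pos[OF C1(1)] by auto
  have h2': "(h2 has_derivative
      (\<lambda>d. c * D (pos d) + (grad h (pos x) \<bullet> Q d + H (pos d) \<bullet> pos (drift x)))) (at x)"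
    unfolding eq
    by (intro has_derivative_add has_derivative_mult_right has_derivative_inner Q
        has_derivative_compose[OF pos' D] has_derivative_compose[OF pos' H])
  then show "h2 differentiable at x"
    unfolding differentiable_def by blast
  have zero: "D 0 = 0" "H 0 = 0"
    using D H by (auto dest: has_derivative_bounded_linear bounded_linear.linear linear_0)
  have pos_g: "pos g\<^sub>v = 0" "pos g\<^sub>\<theta> = 0"
    by (simp_all add: pos_def g\<^sub>v_def g\<^sub>\<theta>_def vec_eq_iff forall_2)
  have Q_g: "Q g\<^sub>v = vector [cos (x $ 4), sin (x $ 4)]"
    "Q g\<^sub>\<theta> = x $ 3 *\<^sub>R vector [- sin (x $ 4), cos (x $ 4)]"
    by (simp_all add: Q_def g\<^sub>v_def g\<^sub>\<theta>_def vec_eq_iff forall_2)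
  show "grad h2 x \<bullet> g\<^sub>v = grad h (pos x) \<bullet> vector [cos (x $ 4), sin (x $ 4)]"
    using has_derivative_grad[OF h2', of g\<^sub>v]
    by (simp add: pos_g zero Q_g)
  show "grad h2 x \<bullet> g\<^sub>\<theta> = x $ 3 * (grad h (pos x) \<bullet> vector [- sin (x $ 4), cos (x $ 4)])"
    using has_derivative_grad[OF h2', of g\<^sub>\<theta>]
    by (simp add: pos_g zero Q_g)
qed

lemma orthogonal_to_heading_and_normal:
  fixes w :: "real^2"
  assumes e: "w \<bullet> vector [cos t, sin t] = 0" and n: "w \<bullet> vector [- sin t, cos t] = 0"
  shows "w = 0"
proof -
  have e': "w $ 1 * cos t + w $ 2 * sin t = 0" and n': "w $ 2 * cos t - w $ 1 * sin t = 0"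
    using e n by (simp_all add: inner_vec_def sum_2)
  \<comment> \<open>The squared components of \<open>w\<close> in the basis \<open>e, n\<close> add up to its squared norm.\<close>
  have "(w $ 1)\<^sup>2 + (w $ 2)\<^sup>2 = ((w $ 1)\<^sup>2 + (w $ 2)\<^sup>2) * ((cos t)\<^sup>2 + (sin t)\<^sup>2)"
    by simp
  also have "\<dots> = (w $ 1 * cos t + w $ 2 * sin t)\<^sup>2 + (w $ 2 * cos t - w $ 1 * sin t)\<^sup>2"
    by algebra
  finally have "(w $ 1)\<^sup>2 + (w $ 2)\<^sup>2 = 0"
    by (simp add: e' n')
  then show ?thesis
    by (simp add: vec_eq_iff forall_2 sum_power2_eq_zero_iff)
qed

text \<open>A vanishing speed component of \<open>L_g h\<^sub>2\<close> makes \<open>\<nabla>h\<close> normal to the heading. Since \<open>\<nabla>h\<close>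
  is nonzero, turning the heading then changes \<open>v (\<nabla>h \<bullet> e)\<close> to first order unless \<open>v = 0\<close>.\<close>

lemma standstill_if_L_g_zero:
  assumes "C2 h"
    and "h2 = (\<lambda>x. c * h (pos x) + L_f (h \<circ> pos) x)"
    and "grad h (pos x) \<noteq> 0"
    and L_g: "L_g h2 x = 0"
  shows "x $ 3 = 0"
proof -
  have "grad h (pos x) \<bullet> vector [cos (x $ 4), sin (x $ 4)] = 0"
    and "x $ 3 * (grad h (pos x) \<bullet> vector [- sin (x $ 4), cos (x $ 4)]) = 0"
    using L_g partials_h2[OF assms(1,2), of x] L_g_components[of h2 x] by simp_all
  with \<open>grad h (pos x) \<noteq> 0\<close> orthogonal_to_heading_and_normal show ?thesis
    by auto
qed

lemma L_g_const_minus: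
  assumes "h differentiable at x"
  shows "L_g (\<lambda>x. b - h x) x = - L_g h x"
proof -
  obtain D where D: "(h has_derivative D) (at x)"
    using assms unfolding differentiable_def by blast
  have "((\<lambda>x. b - h x) has_derivative (\<lambda>d. 0 - D d)) (at x)"
    by (intro has_derivative_diff has_derivative_const D)
  then have "grad (\<lambda>x. b - h x) x \<bullet> d = - (grad h x \<bullet> d)" for d
    using has_derivative_grad[of _ _ x d] D by fastforce
  then show ?thesis
    by (simp add: vec_eq_iff forall_2 L_g_components)
qed

section \<open>Validity of the barrier functions\<close>

text \<open>Where the function is nonnegative, \<open>- \<alpha> (h x) \<le> 0\<close> for every \<open>\<alpha>\<close>, and a vanishing drift gives
  \<open>L_f h x = 0\<close>; so the identity serves as \<open>\<alpha>\<close>.\<close>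

lemma valid_CBF_on_if_standstill:
  assumes "\<And>x. x \<in> S \<Longrightarrow> 0 \<le> h x"
    and "\<And>x. x \<in> S \<Longrightarrow> L_g h x = 0 \<Longrightarrow> x $ 3 = 0"
  shows "valid_CBF_on S h"
  unfolding valid_CBF_on_def
proof (rule exI[of _ "\<lambda>s. s"], intro conjI ballI impI)
  show "ext_class_K_inf (\<lambda>s. s)"
    by (simp add: ext_class_K_inf_def strict_mono_def filterlim_ident)
next
  fix x assume "x \<in> S" "L_g h x = 0"
  with assms show "L_f h x \<ge> - h x"
    by (simp add: L_f_standstill)
qed

theorem theorem4:
  fixes h\<^sub>1 k\<^sub>1 :: "real^2 \<Rightarrow> real"
    and h\<^sub>2 k\<^sub>2 :: "real^4 \<Rightarrow> real"
    and b\<^sub>1 b\<^sub>2 c\<^sub>1 :: real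
    and x\<^sub>0 :: "real^4"
    and C_h2 C_k2 :: "(real^4) set"
  assumes "parallel_constraints b\<^sub>1 h\<^sub>1 k\<^sub>1"
    and "C2 h\<^sub>1" and "C2 k\<^sub>1"
    and "h\<^sub>1 (pos x\<^sub>0) > 0" and "k\<^sub>1 (pos x\<^sub>0) > 0"
    and "b\<^sub>2 = c\<^sub>1 * b\<^sub>1"
    and "h\<^sub>2 = (\<lambda>x. c\<^sub>1 * h\<^sub>1 (pos x) + L_f (h\<^sub>1 \<circ> pos) x)"
    and "k\<^sub>2 = (\<lambda>x. b\<^sub>2 - h\<^sub>2 x)"
    and "c\<^sub>1 > max (- (L_f (h\<^sub>1 \<circ> pos) x\<^sub>0 / h\<^sub>1 (pos x\<^sub>0)))
                 (L_f (h\<^sub>1 \<circ> pos) x\<^sub>0 / (b\<^sub>1 - h\<^sub>1 (pos x\<^sub>0)))"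
    and "\<forall>p \<in> safe_set h\<^sub>1 \<inter> safe_set k\<^sub>1. grad h\<^sub>1 p \<noteq> 0"
    and "C_h2 = safe_set (h\<^sub>1 \<circ> pos) \<inter> safe_set h\<^sub>2"
    and "C_k2 = safe_set (k\<^sub>1 \<circ> pos) \<inter> safe_set k\<^sub>2"
  shows "valid_CBF_on (C_h2 \<inter> C_k2) h\<^sub>2 \<and> valid_CBF_on (C_h2 \<inter> C_k2) k\<^sub>2"
proof -
  let ?S = "C_h2 \<inter> C_k2"
  have nonneg: "0 \<le> h\<^sub>2 x" "0 \<le> k\<^sub>2 x" if "x \<in> ?S" for x
    using that assms(11,12) by (simp_all add: safe_set_def)
  have grad: "grad h\<^sub>1 (pos x) \<noteq> 0" if "x \<in> ?S" for x
    using that assms(10-12) by (simp add: safe_set_def)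
  have standstill: "x $ 3 = 0" if "x \<in> ?S" "L_g h\<^sub>2 x = 0" for x
    using standstill_if_L_g_zero[OF assms(2,7) grad that(2)] that(1) .
  have "L_g k\<^sub>2 x = - L_g h\<^sub>2 x" for x
    unfolding assms(8) by (rule L_g_const_minus[OF partials_h2(1)[OF assms(2,7)]])
  then have standstill': "x $ 3 = 0" if "x \<in> ?S" "L_g k\<^sub>2 x = 0" for x
    using that standstill by simp
  show ?thesis
  proof
    show "valid_CBF_on ?S h\<^sub>2"
      using nonneg(1) standstill by (rule valid_CBF_on_if_standstill)
    show "valid_CBF_on ?S k\<^sub>2"
      using nonneg(2) standstill' by (rule valid_CBF_on_if_standstill)
  qed
qed

end
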